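(* For every digraph $G$, $kpw(G)=dpw(G)$.
   Context: All digraphs are finite and simple. A directed path graph is a DAG whose nodes can be numbered $1,\dots,l$ with arcs exactly $(i,i+1)$ for $1\le i<l$. For $W,X\subseteq V(G)$, $X$ guards $W$ if $W\cap X=\emptyset$ and for every arc $(u,v)$ of $G$ with $u\in W$ we have $v\in W\cup X$. For sets indexed by nodes $1,\dots,l$, write $W_{\ge i}=\bigcup_{k\ge i}W_k$. A directed path decomposition of $G$ is a directed path graph $T$ on nodes $1,\dots,l$ together with subsets $W_1,\dots,W_l$ of $V(G)$ such that: (1) $\bigcup_i W_i=V(G)$; (2) for $i\le j\le k$, $W_i\cap W_k\subseteq W_j$; (3) for each $1\le i<l$, $W_i\cap W_{i+1}$ guards $W_{\ge i+1}\setminus W_i$, and $W_{\ge 1}$ is guarded by $\emptyset$. Its width is $\max_i|W_i|$; $dpw(G)$ is the minimum width. A Kelly path decomposition of $G$ is a directed path graph $T$ on nodes $1,\dots,l$ together with subsets $W_1,\dots,W_l$ and $X_1,\dots,X_l$ of $V(G)$ such that: (1) $W_1,\dots,W_l$ form a partition of $V(G)$; (2) for each $i$, $X_i$ guards $W_{\ge i}$; (3) for each $1\le i<l$, $X_{i+1}\subseteq W_i\cup X_i$. Its width is $\max_i|W_i\cup X_i|$; the Kelly pathwidth $kpw(G)$ is the minimum width of a Kelly path decomposition of $G$. *)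

theory Defs
  imports "Graph_Theory.Digraph" "HOL-Library.Disjoint_Sets"
begin

text \<open>
  A directed path graph on the nodes \<open>1, \<dots>, l\<close> has exactly the arcs \<open>(i, i + 1)\<close> with
  \<open>1 \<le> i < l\<close>, so it is determined by \<open>l\<close>; decompositions therefore carry \<open>l\<close> in place of the
  graph. The path with \<open>l = 0\<close> is possible only for the digraph without vertices, where it is
  the only way to have a partition into nonempty parts.
\<close>

definition guards :: "('a, 'b) pre_digraph \<Rightarrow> 'a set \<Rightarrow> 'a set \<Rightarrow> bool" where
  "guards G X W \<longleftrightarrow>
     W \<inter> X = {} \<and> (\<forall>u v. u \<rightarrow>\<^bsub>G\<^esub> v \<longrightarrow> u \<in> W \<longrightarrow> v \<in> W \<union> X)"

definition from_node :: "nat \<Rightarrow> (nat \<Rightarrow> 'a set) \<Rightarrow> nat \<Rightarrow> 'a set" where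
  "from_node l W i = (\<Union>k\<in>{i..l}. W k)"

definition directed_path_decomposition ::
    "('a, 'b) pre_digraph \<Rightarrow> nat \<Rightarrow> (nat \<Rightarrow> 'a set) \<Rightarrow> bool" where
  "directed_path_decomposition G l W \<longleftrightarrow>
     (\<Union>i\<in>{1..l}. W i) = verts G \<and>
     (\<forall>i j k. 1 \<le> i \<and> i \<le> j \<and> j \<le> k \<and> k \<le> l \<longrightarrow> W i \<inter> W k \<subseteq> W j) \<and>
     (\<forall>i. 1 \<le> i \<and> i < l \<longrightarrow> guards G (W i \<inter> W (i + 1)) (from_node l W (i + 1) - W i)) \<and>
     guards G {} (from_node l W 1)"

definition kelly_path_decomposition ::
    "('a, 'b) pre_digraph \<Rightarrow> nat \<Rightarrow> (nat \<Rightarrow> 'a set) \<Rightarrow> (nat \<Rightarrow> 'a set) \<Rightarrow> bool" where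
  "kelly_path_decomposition G l W X \<longleftrightarrow>
     (\<forall>i\<in>{1..l}. X i \<subseteq> verts G) \<and>
     (\<Union>i\<in>{1..l}. W i) = verts G \<and> disjoint_family_on W {1..l} \<and> (\<forall>i\<in>{1..l}. W i \<noteq> {}) \<and>
     (\<forall>i\<in>{1..l}. guards G (X i) (from_node l W i)) \<and>
     (\<forall>i. 1 \<le> i \<and> i < l \<longrightarrow> X (i + 1) \<subseteq> W i \<union> X i)"

text \<open>
  On \<open>nat\<close>, \<open>SUP\<close> over a finite nonempty index set is the maximum; it is \<open>0\<close> for \<open>l = 0\<close>,
  where \<open>Max\<close> would be unspecified.
\<close>

definition dpd_width :: "nat \<Rightarrow> (nat \<Rightarrow> 'a set) \<Rightarrow> nat" where
  "dpd_width l W = (SUP i\<in>{1..l}. card (W i))"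

definition kpd_width :: "nat \<Rightarrow> (nat \<Rightarrow> 'a set) \<Rightarrow> (nat \<Rightarrow> 'a set) \<Rightarrow> nat" where
  "kpd_width l W X = (SUP i\<in>{1..l}. card (W i \<union> X i))"

definition dpw :: "('a, 'b) pre_digraph \<Rightarrow> nat" where
  "dpw G = (LEAST w. \<exists>l W. directed_path_decomposition G l W \<and> dpd_width l W = w)"

definition kpw :: "('a, 'b) pre_digraph \<Rightarrow> nat" where
  "kpw G = (LEAST w. \<exists>l W X. kelly_path_decomposition G l W X \<and> kpd_width l W X = w)"

text \<open>Both minima range over nonempty sets, so they are attained.\<close>

lemma (in wf_digraph) dpw_attained:
  "\<exists>l W. directed_path_decomposition G l W \<and> dpd_width l W = dpw G"
proof -
  have "directed_path_decomposition G 1 (\<lambda>_. verts G)"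
    by (auto simp: directed_path_decomposition_def guards_def from_node_def adj_in_verts)
  then have "\<exists>w l W. directed_path_decomposition G l W \<and> dpd_width l W = w" by blast
  from LeastI_ex[OF this] show ?thesis unfolding dpw_def .
qed

lemma (in wf_digraph) kpw_attained:
  "\<exists>l W X. kelly_path_decomposition G l W X \<and> kpd_width l W X = kpw G"
proof -
  have "kelly_path_decomposition G (if verts G = {} then 0 else 1) (\<lambda>_. verts G) (\<lambda>_. {})"
    by (auto simp: kelly_path_decomposition_def guards_def from_node_def adj_in_verts
        disjoint_family_on_def)
  then have "\<exists>w l W X. kelly_path_decomposition G l W X \<and> kpd_width l W X = w" by blast
  from LeastI_ex[OF this] show ?thesis unfolding kpw_def .
qed

end

theory Submission
  imports Defs
begin

text \<open>
  If \<open>(W, X)\<close> is a Kelly path decomposition, then the bags \<open>W i \<union> X i\<close> form a directed path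
  decomposition: an element of \<open>X k\<close> lies, for every \<open>i \<le> k\<close>, in \<open>X i\<close> or in some \<open>W m\<close> with
  \<open>i \<le> m < k\<close>, and \<open>X i\<close> avoids \<open>W m\<close> for all \<open>m \<ge> i\<close>. Conversely, from a directed path
  decomposition \<open>W\<close> one takes the new vertices \<open>W i - W (i - 1)\<close> as parts and the old vertices
  \<open>W i \<inter> W (i - 1)\<close> as guards. Some of these parts may be empty; a node \<open>i\<close> with empty part can
  be skipped, because then \<open>X (i + 1) \<subseteq> X i\<close>. Both translations preserve the bags, hence the
  width.
\<close>

text \<open>The supremum of the empty set of naturals is 0, so the equivalence also covers the path
  with \<open>l = 0\<close>, which conditional completeness alone does not.\<close>

lemma SUP_nat_le_iff:
  fixes f :: "'a \<Rightarrow> nat"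
  assumes "finite I"
  shows "(SUP i\<in>I. f i) \<le> w \<longleftrightarrow> (\<forall>i\<in>I. f i \<le> w)"
proof (cases "I = {}")
  case False
  then show ?thesis using assms by (intro cSUP_le_iff) auto
qed (simp add: Sup_nat_empty)

lemma kpd_width_le_iff: "kpd_width l W X \<le> w \<longleftrightarrow> (\<forall>i\<in>{1..l}. card (W i \<union> X i) \<le> w)"
  unfolding kpd_width_def by (rule SUP_nat_le_iff) simp

text \<open>Parts may be empty here, since a bag of a directed path decomposition may bring no new
  vertex. Nonempty parts are restored later by deleting nodes.\<close>

definition weak_kelly_path_decomposition ::
    "('a, 'b) pre_digraph \<Rightarrow> nat \<Rightarrow> (nat \<Rightarrow> 'a set) \<Rightarrow> (nat \<Rightarrow> 'a set) \<Rightarrow> bool" where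
  "weak_kelly_path_decomposition G l W X \<longleftrightarrow>
     (\<forall>i\<in>{1..l}. X i \<subseteq> verts G) \<and>
     (\<Union>i\<in>{1..l}. W i) = verts G \<and> disjoint_family_on W {1..l} \<and>
     (\<forall>i\<in>{1..l}. guards G (X i) (from_node l W i)) \<and>
     (\<forall>i. 1 \<le> i \<and> i < l \<longrightarrow> X (i + 1) \<subseteq> W i \<union> X i)"

lemma kelly_path_decomposition_iff_weak:
  "kelly_path_decomposition G l W X \<longleftrightarrow>
     weak_kelly_path_decomposition G l W X \<and> (\<forall>i\<in>{1..l}. W i \<noteq> {})"
  unfolding kelly_path_decomposition_def weak_kelly_path_decomposition_def by blast

text \<open>Each inclusion \<open>X (k + 1) \<subseteq> W k \<union> X k\<close> traces a guard
  vertex one node back, until some part contains it or \<open>X i\<close> is reached.\<close>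

lemma weak_kelly_guard_origin:
  assumes K: "weak_kelly_path_decomposition G l W X"
    and "1 \<le> i" "i \<le> k" "k \<le> l" "v \<in> X k"
  shows "v \<in> X i \<or> (\<exists>m. i \<le> m \<and> m < k \<and> v \<in> W m)"
  using assms(3-5)
proof (induction k rule: dec_induct)
  case base
  then show ?case by simp
next
  case (step k)
  have "X (k + 1) \<subseteq> W k \<union> X k"
    using K step.hyps step.prems \<open>1 \<le> i\<close> unfolding weak_kelly_path_decomposition_def by auto
  then have "v \<in> W k \<or> v \<in> X k" using step.prems by auto
  then show ?case using step by (meson Suc_leD less_SucI lessI)
qed

lemma weak_kelly_bag_avoids_later_part:
  assumes K: "weak_kelly_path_decomposition G l W X"
    and "1 \<le> i" "i < m" "m \<le> l" "v \<in> W m"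
  shows "v \<notin> W i \<union> X i"
proof -
  have "v \<in> from_node l W i" using assms unfolding from_node_def by auto
  moreover have "guards G (X i) (from_node l W i)" and "disjoint_family_on W {1..l}"
    using assms unfolding weak_kelly_path_decomposition_def by auto
  moreover have "W i \<inter> W m = {}"
    using \<open>disjoint_family_on W {1..l}\<close> assms(2-4) by (intro disjoint_family_onD) auto
  ultimately show ?thesis using assms(5) unfolding guards_def by blast
qed

lemma (in wf_digraph) weak_kelly_imp_directed_path_decomposition:
  assumes K: "weak_kelly_path_decomposition G l W X"
  shows "directed_path_decomposition G l (\<lambda>i. W i \<union> X i)"
proof -
  let ?B = "\<lambda>i. W i \<union> X i"
  have X: "X i \<subseteq> verts G" and guard: "guards G (X i) (from_node l W i)" if "i \<in> {1..l}" for i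
    using K that unfolding weak_kelly_path_decomposition_def by auto
  have UN: "(\<Union>i\<in>{1..l}. W i) = verts G"
    using K unfolding weak_kelly_path_decomposition_def by auto
  have cover: "(\<Union>i\<in>{1..l}. ?B i) = verts G" using UN X by blast
  have interpolation: "?B i \<inter> ?B k \<subseteq> ?B j" if ijk: "1 \<le> i" "i \<le> j" "j \<le> k" "k \<le> l" for i j k
  proof
    fix v assume v: "v \<in> ?B i \<inter> ?B k"
    \<comment> \<open>As \<open>v\<close> is in the bag at \<open>i\<close>, no part strictly after
      \<open>i\<close> contains it. In the cases below this forces every part met at or after
      \<open>i\<close> to be \<open>W i\<close>.\<close>
    have late: "m = i" if "i \<le> m" "m \<le> l" "v \<in> W m" for m
      using weak_kelly_bag_avoids_later_part[OF K \<open>1 \<le> i\<close>, of m v] that v by fastforce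
    show "v \<in> ?B j"
    proof (cases "v \<in> W k")
      case True
      then have "k = i" using late that by auto
      then show ?thesis using v that by auto
    next
      case False
      then have "v \<in> X k" using v by auto
      then consider "v \<in> X j" | m where "j \<le> m" "m < k" "v \<in> W m"
        using weak_kelly_guard_origin[OF K, of j k v] ijk by auto
      then show ?thesis
      proof cases
        case 2
        then have "m = j" using late[of m] that by auto
        then show ?thesis using 2 by simp
      qed simp
    qed
  qed
  \<comment> \<open>Beyond their parts, the bags from \<open>i + 1\<close> on contain only vertices
    of \<open>X (i + 1)\<close>, all of which lie in the bag at \<open>i\<close>. Hence the set to
    be guarded is \<open>from_node l W (i + 1)\<close>. The separator contains its guard
    \<open>X (i + 1)\<close> and is still disjoint from it.\<close>
  have "guards G (?B i \<inter> ?B (i + 1)) (from_node l ?B (i + 1) - ?B i)" if i: "1 \<le> i" "i < l" for i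
  proof -
    have X_step: "X (i + 1) \<subseteq> ?B i"
      using K i unfolding weak_kelly_path_decomposition_def by auto
    have avoid: "from_node l W (i + 1) \<inter> ?B i = {}"
      using weak_kelly_bag_avoids_later_part[OF K i(1)] unfolding from_node_def by (auto simp: Suc_le_eq)
    have "X k \<subseteq> X (i + 1) \<union> from_node l W (i + 1)" if "i + 1 \<le> k" "k \<le> l" for k
      using weak_kelly_guard_origin[OF K, of "i + 1" k] that unfolding from_node_def by fastforce
    then have "from_node l ?B (i + 1) \<subseteq> X (i + 1) \<union> from_node l W (i + 1)"
      unfolding from_node_def by fastforce
    moreover have "from_node l W (i + 1) \<subseteq> from_node l ?B (i + 1)"
      unfolding from_node_def by auto
    ultimately have "from_node l ?B (i + 1) - ?B i = from_node l W (i + 1)"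
      using X_step avoid by blast
    moreover have "guards G (X (i + 1)) (from_node l W (i + 1))" using guard i by auto
    ultimately show ?thesis using X_step avoid unfolding guards_def by blast
  qed
  moreover have "guards G {} (from_node l ?B 1)"
    using cover by (auto simp: guards_def from_node_def adj_in_verts)
  ultimately show ?thesis
    using cover interpolation unfolding directed_path_decomposition_def by blast
qed

text \<open>\<open>P i\<close> is the previous bag, empty at the first node because nothing
  constrains \<open>W 0\<close>. The new vertices from \<open>i\<close> on form
  \<open>from_node l W i - P i\<close>, so the separator condition between \<open>i - 1\<close> and
  \<open>i\<close> becomes the guard condition at \<open>i\<close>.\<close>

lemma directed_imp_weak_kelly_path_decomposition:
  assumes D: "directed_path_decomposition G l W"
  defines "P \<equiv> \<lambda>i. if i \<le> 1 then {} else W (i - 1)"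
  shows "weak_kelly_path_decomposition G l (\<lambda>i. W i - P i) (\<lambda>i. W i \<inter> P i)"
proof -
  have UN: "(\<Union>i\<in>{1..l}. W i) = verts G"
    and inter: "\<And>i j k. 1 \<le> i \<Longrightarrow> i \<le> j \<Longrightarrow> j \<le> k \<Longrightarrow> k \<le> l \<Longrightarrow> W i \<inter> W k \<subseteq> W j"
    and guard: "\<And>i. 1 \<le> i \<Longrightarrow> i < l \<Longrightarrow>
      guards G (W i \<inter> W (i + 1)) (from_node l W (i + 1) - W i)"
    and guard1: "guards G {} (from_node l W 1)"
    using D unfolding directed_path_decomposition_def by auto
  \<comment> \<open>Interpolation at \<open>k - 1\<close> gives this; consequently each vertex is
    new in at most one bag.\<close>
  have earlier: "v \<in> P k" if "1 \<le> i" "i < k" "k \<le> l" "v \<in> W i" "v \<in> W k" for i k v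
    using inter[of i "k - 1" k] that unfolding P_def by fastforce
  \<comment> \<open>Walking back from \<open>k\<close> while the previous bag contains
    \<open>v\<close> ends where \<open>v\<close> is new; \<open>v \<notin> P i\<close> stops the
    walk at \<open>i\<close> at the latest.\<close>
  have first: "\<exists>m. i \<le> m \<and> m \<le> k \<and> v \<in> W m - P m"
    if "1 \<le> i" "i \<le> k" "v \<in> W k" "v \<notin> P i" for i k v
    using that(2,3)
  proof (induction k rule: dec_induct)
    case base
    then show ?case using that by blast
  next
    case (step k)
    show ?case
    proof (cases "v \<in> W k")
      case True
      then show ?thesis using step.IH by (meson le_SucI)
    next
      case False
      then have "v \<notin> P (Suc k)" using step.hyps \<open>1 \<le> i\<close> by (auto simp: P_def)
      then show ?thesis using step by (meson DiffI le_SucI order_refl)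
    qed
  qed
  have from_node: "from_node l (\<lambda>i. W i - P i) i = from_node l W i - P i" if i: "1 \<le> i" for i
  proof
    show "from_node l (\<lambda>i. W i - P i) i \<subseteq> from_node l W i - P i"
    proof
      fix v assume "v \<in> from_node l (\<lambda>i. W i - P i) i"
      then obtain k where k: "i \<le> k" "k \<le> l" "v \<in> W k" "v \<notin> P k" unfolding from_node_def by auto
      have "v \<notin> P i"
        using earlier[of "i - 1" k v] k i by (cases "i = 1") (fastforce simp: P_def)+
      then show "v \<in> from_node l W i - P i" using k unfolding from_node_def by auto
    qed
    show "from_node l W i - P i \<subseteq> from_node l (\<lambda>i. W i - P i) i"
    proof
      fix v assume "v \<in> from_node l W i - P i"
      then obtain k where "i \<le> k" "k \<le> l" "v \<in> W k" "v \<notin> P i" unfolding from_node_def by auto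
      with first[OF i] obtain m where "i \<le> m" "m \<le> k" "v \<in> W m - P m" by blast
      then show "v \<in> from_node l (\<lambda>i. W i - P i) i"
        using \<open>k \<le> l\<close> unfolding from_node_def by auto
    qed
  qed
  have "(\<Union>i\<in>{1..l}. W i - P i) = verts G"
    using from_node[of 1] UN unfolding from_node_def by (simp add: P_def)
  moreover have "disjoint_family_on (\<lambda>i. W i - P i) {1..l}"
    unfolding disjoint_family_on_def using earlier by (auto simp: neq_iff)
  moreover have "guards G (W i \<inter> P i) (from_node l (\<lambda>i. W i - P i) i)" if i: "i \<in> {1..l}" for i
  proof (cases "i = 1")
    case True
    then show ?thesis using guard1 from_node[of 1] by (simp add: P_def)
  next
    case False
    then have "1 \<le> i - 1" "i - 1 < l" using i by auto
    from guard[OF this] show ?thesis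
      using from_node[of i] i False by (simp add: P_def Int_commute)
  qed
  moreover have "W (i + 1) \<inter> P (i + 1) \<subseteq> (W i - P i) \<union> (W i \<inter> P i)" if "1 \<le> i" for i
    using that by (auto simp: P_def)
  moreover have "\<forall>i\<in>{1..l}. W i \<inter> P i \<subseteq> verts G" using UN by blast
  ultimately show ?thesis
    unfolding weak_kelly_path_decomposition_def by simp
qed

text \<open>\<open>s\<close> enumerates the indices other than \<open>i\<close> in increasing order.
  The empty part adds nothing to any union, so \<open>from_node\<close> is preserved along
  \<open>s\<close>.\<close>

lemma weak_kelly_skip_empty_part:
  assumes K: "weak_kelly_path_decomposition G (Suc l) W X"
    and i: "i \<in> {1..Suc l}" and empty: "W i = {}"
  defines "s \<equiv> \<lambda>k. if k < i then k else Suc k"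
  shows "weak_kelly_path_decomposition G l (W \<circ> s) (X \<circ> s)"
proof -
  have image: "s ` {k..l} = {s k..Suc l} - {i}" for k
  proof
    show "s ` {k..l} \<subseteq> {s k..Suc l} - {i}" using i by (auto simp: s_def)
    show "{s k..Suc l} - {i} \<subseteq> s ` {k..l}"
    proof
      fix m assume m: "m \<in> {s k..Suc l} - {i}"
      show "m \<in> s ` {k..l}"
      proof (cases "m < i")
        case True
        then show ?thesis using m i by (intro image_eqI[of _ _ m]) (auto simp: s_def split: if_splits)
      next
        case False
        then show ?thesis
          using m i by (intro image_eqI[of _ _ "m - 1"]) (auto simp: s_def split: if_splits)
      qed
    qed
  qed
  have s_in: "s k \<in> {1..Suc l}" if "k \<in> {1..l}" for k using that by (auto simp: s_def)
  have from_node: "from_node l (W \<circ> s) k = from_node (Suc l) W (s k)" for k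
  proof -
    have "from_node l (W \<circ> s) k = (\<Union>m\<in>s ` {k..l}. W m)"
      unfolding from_node_def by simp
    also have "\<dots> = from_node (Suc l) W (s k)"
      unfolding image from_node_def using empty by blast
    finally show ?thesis .
  qed
  have "(\<Union>k\<in>{1..l}. (W \<circ> s) k) = (\<Union>m\<in>{s 1..Suc l} - {i}. W m)"
    unfolding image[symmetric] by simp
  \<comment> \<open>\<open>s 1\<close> is 2 exactly when \<open>i = 1\<close>, and then the index
    left out is \<open>i\<close> itself.\<close>
  also have "{s 1..Suc l} - {i} = {1..Suc l} - {i}" using i by (auto simp: s_def)
  also have "(\<Union>m\<in>{1..Suc l} - {i}. W m) = verts G"
    using K empty unfolding weak_kelly_path_decomposition_def by blast
  finally have "(\<Union>k\<in>{1..l}. (W \<circ> s) k) = verts G" .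
  moreover have "disjoint_family_on (W \<circ> s) {1..l}"
  proof -
    have "s k \<noteq> s m" if "k \<noteq> m" for k m using that by (auto simp: s_def)
    then show ?thesis
      using K s_in unfolding weak_kelly_path_decomposition_def disjoint_family_on_def by auto
  qed
  moreover have "(X \<circ> s) (k + 1) \<subseteq> (W \<circ> s) k \<union> (X \<circ> s) k" if k: "1 \<le> k" "k < l" for k
  proof -
    have step: "X (m + 1) \<subseteq> W m \<union> X m" if "1 \<le> m" "m < Suc l" for m
      using K that unfolding weak_kelly_path_decomposition_def by blast
    show ?thesis
    proof (cases "k + 1 = i")
      case True
      \<comment> \<open>Across the gap two inclusions compose:
        \<open>X (i + 1) \<subseteq> X i\<close>, as \<open>W i\<close> is empty, and
        \<open>X i \<subseteq> W k \<union> X k\<close>, as \<open>i = k + 1\<close>.\<close>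
      then have "X (i + 1) \<subseteq> W k \<union> X k" using step[of i] step[of k] k empty by auto
      then show ?thesis using True by (simp add: s_def)
    next
      case False
      then have "s (k + 1) = s k + 1" by (auto simp: s_def)
      then show ?thesis using step[of "s k"] k by (auto simp: s_def split: if_splits)
    qed
  qed
  ultimately show ?thesis
    using K s_in unfolding weak_kelly_path_decomposition_def by (simp add: from_node)
qed

text \<open>Induction on the number of nodes, deleting one node with empty part at a time. The width
  is only bounded by \<open>w\<close>, because a deleted node may have had the largest bag.\<close>

lemma weak_kelly_imp_kelly_path_decomposition:
  assumes "weak_kelly_path_decomposition G l W X" and "kpd_width l W X \<le> w"
  shows "\<exists>l' W' X'. kelly_path_decomposition G l' W' X' \<and> kpd_width l' W' X' \<le> w"
  using assms
proof (induction l arbitrary: W X)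
  case 0
  then have "kelly_path_decomposition G 0 W X" by (simp add: kelly_path_decomposition_iff_weak)
  then show ?case using "0.prems" by blast
next
  case (Suc l)
  show ?case
  proof (cases "\<forall>i\<in>{1..Suc l}. W i \<noteq> {}")
    case True
    then show ?thesis using Suc.prems kelly_path_decomposition_iff_weak by blast
  next
    case False
    then obtain i where i: "i \<in> {1..Suc l}" "W i = {}" by blast
    define s where "s \<equiv> \<lambda>k. if k < i then k else Suc k"
    have "weak_kelly_path_decomposition G l (W \<circ> s) (X \<circ> s)"
      unfolding s_def by (rule weak_kelly_skip_empty_part[OF Suc.prems(1) i])
    moreover have "kpd_width l (W \<circ> s) (X \<circ> s) \<le> w"
      using Suc.prems(2) by (auto simp: kpd_width_le_iff s_def)
    ultimately show ?thesis by (rule Suc.IH)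
  qed
qed

lemma (in wf_digraph) dpw_le_kpw: "dpw G \<le> kpw G"
proof -
  obtain l W X where K: "kelly_path_decomposition G l W X" and w: "kpd_width l W X = kpw G"
    using kpw_attained by blast
  have "directed_path_decomposition G l (\<lambda>i. W i \<union> X i)"
    using K by (simp add: kelly_path_decomposition_iff_weak weak_kelly_imp_directed_path_decomposition)
  moreover have "dpd_width l (\<lambda>i. W i \<union> X i) = kpw G"
    using w by (simp add: dpd_width_def kpd_width_def)
  ultimately show ?thesis unfolding dpw_def by (blast intro: Least_le)
qed

lemma (in wf_digraph) kpw_le_dpw: "kpw G \<le> dpw G"
proof -
  obtain l W where D: "directed_path_decomposition G l W" and w: "dpd_width l W = dpw G"
    using dpw_attained by blast
  let ?P = "\<lambda>i. if i \<le> 1 then {} else W (i - 1)"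
  have "kpd_width l (\<lambda>i. W i - ?P i) (\<lambda>i. W i \<inter> ?P i) \<le> dpw G"
    unfolding w[symmetric] dpd_width_def kpd_width_def by (simp only: Un_Diff_Int order_refl)
  from weak_kelly_imp_kelly_path_decomposition
    [OF directed_imp_weak_kelly_path_decomposition[OF D] this]
  obtain l' W' X' where "kelly_path_decomposition G l' W' X'" "kpd_width l' W' X' \<le> dpw G"
    by blast
  moreover from this(1) have "kpw G \<le> kpd_width l' W' X'"
    unfolding kpw_def by (blast intro: Least_le)
  ultimately show ?thesis by simp
qed

theorem mainTheorem5:
  fixes G :: "('a, 'b) pre_digraph"
  assumes "digraph G"
  shows "kpw G = dpw G"
proof -
  interpret digraph G by (rule assms)
  show ?thesis using kpw_le_dpw dpw_le_kpw by (rule antisym)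
qed

end
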